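(* Let $S$ be an intra-regular $\Gamma$-AG$^{**}$-groupoid and let $f$ be a fuzzy subset of $S$. Then the following conditions are equivalent. (i) $f$ is a fuzzy $\Gamma$-left ideal of $S$. (ii) $f$ is a fuzzy $\Gamma$-right ideal of $S$. (iii) $f$ is a fuzzy $\Gamma$-two-sided ideal of $S$. (iv) $f$ is a fuzzy $\Gamma$-bi-ideal of $S$. (v) $f$ is a fuzzy $\Gamma$-generalized bi-ideal of $S$. (vi) $f$ is a fuzzy $\Gamma$-interior ideal of $S$. (vii) $f$ is a fuzzy $\Gamma$-quasi ideal of $S$. (viii) $S\circ_\Gamma f=f=f\circ_\Gamma S$.
   Context: Let $S,\Gamma$ be nonempty sets with a map $S\times\Gamma\times S\to S$, $(x,\alpha,y)\mapsto x\alpha y$. $S$ is a $\Gamma$-AG-groupoid if $(x\alpha y)\beta z=(z\alpha y)\beta x$ for all $x,y,z\in S$, $\alpha,\beta\in\Gamma$. It is a $\Gamma$-AG$^{**}$-groupoid if moreover $x\alpha(y\beta z)=y\alpha(x\beta z)$ for all $x,y,z\in S$, $\alpha,\beta\in\Gamma$. $S$ is intra-regular if for every $a\in S$ there exist $x,y\in S$ and $\beta,\gamma,\xi\in\Gamma$ with $a=(x\beta(a\xi a))\gamma y$. A fuzzy subset of $S$ is a function $f:S\to[0,1]$. The symbol $S$, used as a fuzzy subset, denotes the constant function $1$. For fuzzy subsets $f,g$: $f\subseteq g$ means $f(x)\le g(x)$ for all $x\in S$; $(f\cap g)(x)=f(x)\wedge g(x)$ ($\wedge$ = minimum); and the $\Gamma$-product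 is $(f\circ_\Gamma g)(a)=\bigvee_{a=b\alpha c}\{f(b)\wedge g(c)\}$, the supremum over all $b,c\in S$, $\alpha\in\Gamma$ with $a=b\alpha c$, and $(f\circ_\Gamma g)(a)=0$ if no such $b,c,\alpha$ exist. For all $x,y,z\in S$ and $\alpha,\beta\in\Gamma$, a fuzzy subset $f$ is called: a fuzzy $\Gamma$-AG-subgroupoid if $f(x\alpha y)\ge f(x)\wedge f(y)$; a fuzzy $\Gamma$-left ideal if $f(x\alpha y)\ge f(y)$; a fuzzy $\Gamma$-right ideal if $f(x\alpha y)\ge f(x)$; a fuzzy $\Gamma$-two-sided ideal if it is both a fuzzy $\Gamma$-left and a fuzzy $\Gamma$-right ideal; a fuzzy $\Gamma$-generalized bi-ideal if $f((x\alpha y)\beta z)\ge f(x)\wedge f(z)$; a fuzzy $\Gamma$-bi-ideal if it is a fuzzy $\Gamma$-AG-subgroupoid and $f((x\alpha y)\beta z)\ge f(x)\wedge f(z)$; a fuzzy $\Gamma$-interior ideal if $f((x\alpha y)\beta z)\ge f(y)$; a fuzzy $\Gamma$-quasi ideal if $(f\circ_\Gamma S)\cap(S\circ_\Gamma f)\subseteq f$. *)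

theory Defs
  imports Complex_Main "HOL-Library.FuncSet"
begin

text \<open>
  The sets \<open>S\<close> and \<open>\<Gamma>\<close> are explicit carriers \<open>S\<close> and \<open>G\<close>;
  the ternary map sends \<open>(x, \<alpha>, y)\<close> to \<open>m x \<alpha> y\<close>.
\<close>

locale gamma_groupoid =
  fixes S :: "'s set" and G :: "'g set" and m :: "'s \<Rightarrow> 'g \<Rightarrow> 's \<Rightarrow> 's"
  assumes S_nonempty: "S \<noteq> {}"
    and G_nonempty: "G \<noteq> {}"
    and m_closed: "\<lbrakk>x \<in> S; \<alpha> \<in> G; y \<in> S\<rbrakk> \<Longrightarrow> m x \<alpha> y \<in> S"

locale gamma_AG_groupoid = gamma_groupoid +
  assumes left_invertive:
    "\<lbrakk>x \<in> S; y \<in> S; z \<in> S; \<alpha> \<in> G; \<beta> \<in> G\<rbrakk>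
      \<Longrightarrow> m (m x \<alpha> y) \<beta> z = m (m z \<alpha> y) \<beta> x"

locale gamma_AG_star_star_groupoid = gamma_AG_groupoid +
  assumes left_swap:
    "\<lbrakk>x \<in> S; y \<in> S; z \<in> S; \<alpha> \<in> G; \<beta> \<in> G\<rbrakk>
      \<Longrightarrow> m x \<alpha> (m y \<beta> z) = m y \<alpha> (m x \<beta> z)"

definition intra_regular :: "'s set \<Rightarrow> 'g set \<Rightarrow> ('s \<Rightarrow> 'g \<Rightarrow> 's \<Rightarrow> 's) \<Rightarrow> bool" where
  "intra_regular S G m \<longleftrightarrow>
    (\<forall>a\<in>S. \<exists>x\<in>S. \<exists>y\<in>S. \<exists>\<beta>\<in>G. \<exists>\<gamma>\<in>G. \<exists>\<xi>\<in>G. a = m (m x \<beta> (m a \<xi> a)) \<gamma> y)"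

text \<open>
  Fuzzy subsets of \<open>S\<close> are represented by total functions; only their values on
  \<open>S\<close> matter, so inclusion and equality are relative to \<open>S\<close>.
\<close>

definition fuzzy_subset :: "'s set \<Rightarrow> ('s \<Rightarrow> real) \<Rightarrow> bool" where
  "fuzzy_subset S f \<longleftrightarrow> f \<in> S \<rightarrow> {0..1}"

definition fuzzy_le :: "'s set \<Rightarrow> ('s \<Rightarrow> real) \<Rightarrow> ('s \<Rightarrow> real) \<Rightarrow> bool" where
  "fuzzy_le S f g \<longleftrightarrow> (\<forall>x\<in>S. f x \<le> g x)"

definition fuzzy_eq :: "'s set \<Rightarrow> ('s \<Rightarrow> real) \<Rightarrow> ('s \<Rightarrow> real) \<Rightarrow> bool" where
  "fuzzy_eq S f g \<longleftrightarrow> (\<forall>x\<in>S. f x = g x)"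

definition fuzzy_inter :: "('s \<Rightarrow> real) \<Rightarrow> ('s \<Rightarrow> real) \<Rightarrow> 's \<Rightarrow> real" where
  "fuzzy_inter f g = (\<lambda>x. min (f x) (g x))"

text \<open>The set \<open>S\<close> itself, viewed as a fuzzy subset.\<close>

definition fuzzy_whole :: "'s \<Rightarrow> real" where
  "fuzzy_whole = (\<lambda>x. 1)"

definition fuzzy_prod ::
  "'s set \<Rightarrow> 'g set \<Rightarrow> ('s \<Rightarrow> 'g \<Rightarrow> 's \<Rightarrow> 's) \<Rightarrow> ('s \<Rightarrow> real) \<Rightarrow> ('s \<Rightarrow> real) \<Rightarrow> 's \<Rightarrow> real" where
  "fuzzy_prod S G m f g = (\<lambda>a.
    if \<exists>b\<in>S. \<exists>\<alpha>\<in>G. \<exists>c\<in>S. a = m b \<alpha> c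
    then Sup {min (f b) (g c) | b \<alpha> c. b \<in> S \<and> \<alpha> \<in> G \<and> c \<in> S \<and> a = m b \<alpha> c}
    else 0)"

definition fuzzy_AG_subgroupoid ::
  "'s set \<Rightarrow> 'g set \<Rightarrow> ('s \<Rightarrow> 'g \<Rightarrow> 's \<Rightarrow> 's) \<Rightarrow> ('s \<Rightarrow> real) \<Rightarrow> bool" where
  "fuzzy_AG_subgroupoid S G m f \<longleftrightarrow>
    (\<forall>x\<in>S. \<forall>y\<in>S. \<forall>\<alpha>\<in>G. f (m x \<alpha> y) \<ge> min (f x) (f y))"

definition fuzzy_left_ideal ::
  "'s set \<Rightarrow> 'g set \<Rightarrow> ('s \<Rightarrow> 'g \<Rightarrow> 's \<Rightarrow> 's) \<Rightarrow> ('s \<Rightarrow> real) \<Rightarrow> bool" where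
  "fuzzy_left_ideal S G m f \<longleftrightarrow> (\<forall>x\<in>S. \<forall>y\<in>S. \<forall>\<alpha>\<in>G. f (m x \<alpha> y) \<ge> f y)"

definition fuzzy_right_ideal ::
  "'s set \<Rightarrow> 'g set \<Rightarrow> ('s \<Rightarrow> 'g \<Rightarrow> 's \<Rightarrow> 's) \<Rightarrow> ('s \<Rightarrow> real) \<Rightarrow> bool" where
  "fuzzy_right_ideal S G m f \<longleftrightarrow> (\<forall>x\<in>S. \<forall>y\<in>S. \<forall>\<alpha>\<in>G. f (m x \<alpha> y) \<ge> f x)"

definition fuzzy_two_sided_ideal ::
  "'s set \<Rightarrow> 'g set \<Rightarrow> ('s \<Rightarrow> 'g \<Rightarrow> 's \<Rightarrow> 's) \<Rightarrow> ('s \<Rightarrow> real) \<Rightarrow> bool" where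
  "fuzzy_two_sided_ideal S G m f \<longleftrightarrow> fuzzy_left_ideal S G m f \<and> fuzzy_right_ideal S G m f"

definition fuzzy_generalized_bi_ideal ::
  "'s set \<Rightarrow> 'g set \<Rightarrow> ('s \<Rightarrow> 'g \<Rightarrow> 's \<Rightarrow> 's) \<Rightarrow> ('s \<Rightarrow> real) \<Rightarrow> bool" where
  "fuzzy_generalized_bi_ideal S G m f \<longleftrightarrow>
    (\<forall>x\<in>S. \<forall>y\<in>S. \<forall>z\<in>S. \<forall>\<alpha>\<in>G. \<forall>\<beta>\<in>G. f (m (m x \<alpha> y) \<beta> z) \<ge> min (f x) (f z))"

definition fuzzy_bi_ideal ::
  "'s set \<Rightarrow> 'g set \<Rightarrow> ('s \<Rightarrow> 'g \<Rightarrow> 's \<Rightarrow> 's) \<Rightarrow> ('s \<Rightarrow> real) \<Rightarrow> bool" where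
  "fuzzy_bi_ideal S G m f \<longleftrightarrow>
    fuzzy_AG_subgroupoid S G m f \<and>
    (\<forall>x\<in>S. \<forall>y\<in>S. \<forall>z\<in>S. \<forall>\<alpha>\<in>G. \<forall>\<beta>\<in>G. f (m (m x \<alpha> y) \<beta> z) \<ge> min (f x) (f z))"

definition fuzzy_interior_ideal ::
  "'s set \<Rightarrow> 'g set \<Rightarrow> ('s \<Rightarrow> 'g \<Rightarrow> 's \<Rightarrow> 's) \<Rightarrow> ('s \<Rightarrow> real) \<Rightarrow> bool" where
  "fuzzy_interior_ideal S G m f \<longleftrightarrow>
    (\<forall>x\<in>S. \<forall>y\<in>S. \<forall>z\<in>S. \<forall>\<alpha>\<in>G. \<forall>\<beta>\<in>G. f (m (m x \<alpha> y) \<beta> z) \<ge> f y)"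

definition fuzzy_quasi_ideal ::
  "'s set \<Rightarrow> 'g set \<Rightarrow> ('s \<Rightarrow> 'g \<Rightarrow> 's \<Rightarrow> 's) \<Rightarrow> ('s \<Rightarrow> real) \<Rightarrow> bool" where
  "fuzzy_quasi_ideal S G m f \<longleftrightarrow>
    fuzzy_le S (fuzzy_inter (fuzzy_prod S G m f fuzzy_whole) (fuzzy_prod S G m fuzzy_whole f)) f"

end

theory Submission
  imports Defs
begin

text \<open>
  Everything is reduced to the right ideal property. The two laws make the product medial and
  paramedial, and writing \<open>a = (x(aa))y\<close> one obtains (suppressing the elements of \<open>\<Gamma>\<close>)
  \<open>ab = a(p(qa))\<close>, \<open>ab = (ta)a\<close>, \<open>ta = as\<close> and \<open>ab = (bs)t\<close> for suitable \<open>p, q, s, t\<close>. A value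
  \<open>f(ab)\<close> is then bounded below by \<open>f(a)\<close> or \<open>f(b)\<close> under each of the eight conditions.
\<close>

section \<open>Medial laws and rewritings of a product \<open>ab\<close>\<close>

context gamma_AG_star_star_groupoid
begin

text \<open>Three uses of left invertivity: the block \<open>zw\<close> is exchanged with
  \<open>x\<close>, then \<open>z\<close> with \<open>y\<close> inside \<open>(zw)y\<close>, and
  finally the block \<open>yw\<close> with \<open>x\<close>.\<close>

lemma medial:
  assumes "x \<in> S" "y \<in> S" "z \<in> S" "w \<in> S" "\<alpha> \<in> G" "\<beta> \<in> G" "\<gamma> \<in> G"
  shows "m (m x \<alpha> y) \<beta> (m z \<gamma> w) = m (m x \<alpha> z) \<beta> (m y \<gamma> w)"
proof -
  have "m (m x \<alpha> y) \<beta> (m z \<gamma> w) = m (m (m z \<gamma> w) \<alpha> y) \<beta> x"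
    using assms by (intro left_invertive m_closed)
  also have "m (m z \<gamma> w) \<alpha> y = m (m y \<gamma> w) \<alpha> z"
    using assms by (intro left_invertive)
  also have "m (m (m y \<gamma> w) \<alpha> z) \<beta> x = m (m x \<alpha> z) \<beta> (m y \<gamma> w)"
    using assms by (intro left_invertive m_closed)
  finally show ?thesis .
qed

text \<open>After \<open>left_swap\<close> brings the block \<open>xy\<close> next to
  \<open>w\<close>, left invertivity exchanges \<open>x\<close> and \<open>w\<close>. A second
  \<open>left_swap\<close> gives \<open>(wy)(zx)\<close>, and \<open>medial\<close> exchanges the
  two middle factors.\<close>

lemma paramedial:
  assumes "x \<in> S" "y \<in> S" "z \<in> S" "w \<in> S" "\<alpha> \<in> G" "\<beta> \<in> G" "\<gamma> \<in> G"
  shows "m (m x \<alpha> y) \<beta> (m z \<gamma> w) = m (m w \<alpha> z) \<beta> (m y \<gamma> x)"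
proof -
  have "m (m x \<alpha> y) \<beta> (m z \<gamma> w) = m z \<beta> (m (m x \<alpha> y) \<gamma> w)"
    using assms by (intro left_swap m_closed)
  also have "m (m x \<alpha> y) \<gamma> w = m (m w \<alpha> y) \<gamma> x"
    using assms by (intro left_invertive)
  also have "m z \<beta> (m (m w \<alpha> y) \<gamma> x) = m (m w \<alpha> y) \<beta> (m z \<gamma> x)"
    using assms by (intro left_swap m_closed)
  also have "\<dots> = m (m w \<alpha> z) \<beta> (m y \<gamma> x)"
    using assms by (intro medial)
  finally show ?thesis .
qed

text \<open>The second form of \<open>a\<close> follows from \<open>x(aa) = a(xa)\<close>. It puts
  \<open>a\<close> in the leftmost place, from which left invertivity and \<open>left_swap\<close>
  can move it.\<close>

lemma intra_regularE:
  assumes "intra_regular S G m" "a \<in> S"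
  obtains x y \<beta> \<gamma> \<xi> where "x \<in> S" "y \<in> S" "\<beta> \<in> G" "\<gamma> \<in> G" "\<xi> \<in> G"
    "a = m (m x \<beta> (m a \<xi> a)) \<gamma> y" "a = m (m a \<beta> (m x \<xi> a)) \<gamma> y"
proof -
  obtain x y \<beta> \<gamma> \<xi> where *: "x \<in> S" "y \<in> S" "\<beta> \<in> G" "\<gamma> \<in> G" "\<xi> \<in> G"
    and a: "a = m (m x \<beta> (m a \<xi> a)) \<gamma> y"
    using assms unfolding intra_regular_def by blast
  have "m x \<beta> (m a \<xi> a) = m a \<beta> (m x \<xi> a)"
    using * assms(2) by (intro left_swap)
  \<comment> \<open>A single substitution inside the fact \<open>a\<close>: simplifying with that
    fact would loop, since \<open>a\<close> occurs on its own right-hand side.\<close>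
  then have "a = m (m a \<beta> (m x \<xi> a)) \<gamma> y"
    by (rule subst) (rule a)
  with * a show ?thesis by (rule that)
qed

text \<open>In \<open>(a(xa))y\<close> left invertivity exchanges the leading \<open>a\<close> with
  \<open>y\<close>, so \<open>u = y(xa)\<close>. This factorization later bounds the product of
  \<open>fuzzy_whole\<close> and \<open>f\<close> at \<open>a\<close> from below.\<close>

lemma factor_right:
  assumes "intra_regular S G m" "a \<in> S"
  obtains u \<gamma> where "u \<in> S" "\<gamma> \<in> G" "a = m u \<gamma> a"
proof -
  obtain x y \<beta> \<gamma> \<xi> where *: "x \<in> S" "y \<in> S" "\<beta> \<in> G" "\<gamma> \<in> G" "\<xi> \<in> G"
    and a: "a = m (m a \<beta> (m x \<xi> a)) \<gamma> y"
    using assms by (rule intra_regularE)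
  have "m (m a \<beta> (m x \<xi> a)) \<gamma> y = m (m y \<beta> (m x \<xi> a)) \<gamma> a"
    using * assms(2) by (intro left_invertive m_closed)
  with a have "a = m (m y \<beta> (m x \<xi> a)) \<gamma> a" by (rule trans)
  moreover have "m y \<beta> (m x \<xi> a) \<in> S"
    using * assms(2) by (intro m_closed)
  ultimately show ?thesis using *(4) by (intro that)
qed

text \<open>With \<open>p = by\<close> and \<open>q = x\<close>, the nesting \<open>a(p(qa))\<close>
  ends in \<open>a\<close>, so three left ideal inequalities lead from \<open>f a\<close> to the
  value at \<open>ab\<close>.\<close>

lemma prod_eq_left_multiple:
  assumes "intra_regular S G m" "a \<in> S" "b \<in> S" "\<alpha> \<in> G"
  obtains p q \<beta> \<gamma> \<delta> where "p \<in> S" "q \<in> S" "\<beta> \<in> G" "\<gamma> \<in> G" "\<delta> \<in> G"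
    "m a \<alpha> b = m a \<beta> (m p \<gamma> (m q \<delta> a))"
proof -
  obtain x y \<beta> \<gamma> \<xi> where *: "x \<in> S" "y \<in> S" "\<beta> \<in> G" "\<gamma> \<in> G" "\<xi> \<in> G"
    and a: "a = m (m a \<beta> (m x \<xi> a)) \<gamma> y"
    using assms(1,2) by (rule intra_regularE)
  have "m a \<alpha> b = m (m (m a \<beta> (m x \<xi> a)) \<gamma> y) \<alpha> b"
    \<comment> \<open>Only the displayed left factor \<open>a\<close> is expanded; the copies of
      \<open>a\<close> inside the expansion stay.\<close>
    by (rule arg_cong[OF a])
  also have "\<dots> = m (m b \<gamma> y) \<alpha> (m a \<beta> (m x \<xi> a))"
    using * assms by (intro left_invertive m_closed)
  also have "\<dots> = m a \<alpha> (m (m b \<gamma> y) \<beta> (m x \<xi> a))"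
    using * assms by (intro left_swap m_closed)
  finally have "m a \<alpha> b = m a \<alpha> (m (m b \<gamma> y) \<beta> (m x \<xi> a))" .
  moreover have "m b \<gamma> y \<in> S"
    using * assms by (intro m_closed)
  ultimately show ?thesis using * assms(4) that by blast
qed

text \<open>Expanding \<open>a\<close> gives \<open>(by)(x(aa))\<close>; the paramedial law moves
  the square to the far left as \<open>((aa)x)(yb)\<close>. Left invertivity and a second paramedial
  step then isolate it as \<open>(aa)(x(yb))\<close>.\<close>

lemma prod_eq_square_multiple:
  assumes "intra_regular S G m" "a \<in> S" "b \<in> S" "\<alpha> \<in> G"
  obtains p q \<gamma> \<delta> \<xi> where "p \<in> S" "q \<in> S" "\<gamma> \<in> G" "\<delta> \<in> G" "\<xi> \<in> G"
    "m a \<alpha> b = m (m a \<xi> a) \<gamma> (m p \<delta> q)"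
proof -
  obtain x y \<beta> \<gamma> \<xi> where *: "x \<in> S" "y \<in> S" "\<beta> \<in> G" "\<gamma> \<in> G" "\<xi> \<in> G"
    and a: "a = m (m x \<beta> (m a \<xi> a)) \<gamma> y"
    using assms(1,2) by (rule intra_regularE)
  have "m a \<alpha> b = m (m (m x \<beta> (m a \<xi> a)) \<gamma> y) \<alpha> b"
    by (rule arg_cong[OF a])
  also have "\<dots> = m (m b \<gamma> y) \<alpha> (m x \<beta> (m a \<xi> a))"
    using * assms by (intro left_invertive m_closed)
  also have "\<dots> = m (m (m a \<xi> a) \<gamma> x) \<alpha> (m y \<beta> b)"
    using * assms by (intro paramedial m_closed)
  also have "\<dots> = m (m (m y \<beta> b) \<gamma> x) \<alpha> (m a \<xi> a)"
    using * assms by (intro left_invertive m_closed)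
  also have "\<dots> = m (m a \<gamma> a) \<alpha> (m x \<xi> (m y \<beta> b))"
    using * assms by (intro paramedial m_closed)
  finally have "m a \<alpha> b = m (m a \<gamma> a) \<alpha> (m x \<xi> (m y \<beta> b))" .
  moreover have "m y \<beta> b \<in> S"
    using * assms by (intro m_closed)
  ultimately show ?thesis using * assms(4) that by blast
qed

lemma prod_eq_twice_right_multiple:
  assumes "intra_regular S G m" "a \<in> S" "b \<in> S" "\<alpha> \<in> G"
  obtains t \<beta> \<gamma> where "t \<in> S" "\<beta> \<in> G" "\<gamma> \<in> G" "m a \<alpha> b = m (m t \<beta> a) \<gamma> a"
proof -
  obtain p q \<gamma> \<delta> \<xi> where *: "p \<in> S" "q \<in> S" "\<gamma> \<in> G" "\<delta> \<in> G" "\<xi> \<in> G"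
    and ab: "m a \<alpha> b = m (m a \<xi> a) \<gamma> (m p \<delta> q)"
    using assms by (rule prod_eq_square_multiple)
  note ab
  \<comment> \<open>Left invertivity on \<open>(aa)t\<close> with \<open>t = pq\<close> gives
    \<open>(ta)a\<close>.\<close>
  also have "m (m a \<xi> a) \<gamma> (m p \<delta> q) = m (m (m p \<delta> q) \<xi> a) \<gamma> a"
    using * assms by (intro left_invertive m_closed)
  finally show ?thesis using * m_closed that by blast
qed

text \<open>Expanding \<open>a\<close> inside \<open>ta\<close> exposes the square
  \<open>aa\<close>. The medial and paramedial laws bring it to the end as
  \<open>(y(xt))(aa)\<close>, and \<open>left_swap\<close> pulls one \<open>a\<close> to the front,
  so \<open>s = (y(xt))a\<close>.\<close>

lemma right_multiple_eq_left_multiple: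
  assumes "intra_regular S G m" "a \<in> S" "t \<in> S" "\<alpha> \<in> G"
  obtains s \<beta> where "s \<in> S" "\<beta> \<in> G" "m t \<alpha> a = m a \<beta> s"
proof -
  obtain x y \<beta> \<gamma> \<xi> where *: "x \<in> S" "y \<in> S" "\<beta> \<in> G" "\<gamma> \<in> G" "\<xi> \<in> G"
    and a: "a = m (m x \<beta> (m a \<xi> a)) \<gamma> y"
    using assms(1,2) by (rule intra_regularE)
  have "m t \<alpha> a = m t \<alpha> (m (m x \<beta> (m a \<xi> a)) \<gamma> y)"
    by (rule arg_cong[OF a])
  also have "\<dots> = m (m x \<beta> (m a \<xi> a)) \<alpha> (m t \<gamma> y)"
    using * assms by (intro left_swap m_closed)
  also have "\<dots> = m (m x \<beta> t) \<alpha> (m (m a \<xi> a) \<gamma> y)"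
    using * assms by (intro medial m_closed)
  also have "\<dots> = m (m a \<xi> a) \<alpha> (m (m x \<beta> t) \<gamma> y)"
    using * assms by (intro left_swap m_closed)
  also have "\<dots> = m (m y \<xi> (m x \<beta> t)) \<alpha> (m a \<gamma> a)"
    using * assms by (intro paramedial m_closed)
  also have "\<dots> = m a \<alpha> (m (m y \<xi> (m x \<beta> t)) \<gamma> a)"
    using * assms by (intro left_swap m_closed)
  finally show ?thesis
    \<comment> \<open>The equation is matched first and fixes the witnesses; only their membership
      remains.\<close>
    by (rule that[rotated -1]) (use * assms in \<open>auto intro: m_closed\<close>)
qed

text \<open>Expanding \<open>b\<close> instead of \<open>a\<close> and swapping gives
  \<open>(b(xb))(ay)\<close>. Now \<open>b\<close> is leftmost, so two right ideal inequalities
  reach it.\<close>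

lemma prod_eq_multiple_of_right_factor:
  assumes "intra_regular S G m" "a \<in> S" "b \<in> S" "\<alpha> \<in> G"
  obtains s t \<beta> \<gamma> where "s \<in> S" "t \<in> S" "\<beta> \<in> G" "\<gamma> \<in> G" "m a \<alpha> b = m (m b \<beta> s) \<gamma> t"
proof -
  obtain x y \<beta> \<gamma> \<xi> where *: "x \<in> S" "y \<in> S" "\<beta> \<in> G" "\<gamma> \<in> G" "\<xi> \<in> G"
    and b: "b = m (m b \<beta> (m x \<xi> b)) \<gamma> y"
    using assms(1,3) by (rule intra_regularE)
  have "m a \<alpha> b = m a \<alpha> (m (m b \<beta> (m x \<xi> b)) \<gamma> y)"
    by (rule arg_cong[OF b])
  also have "\<dots> = m (m b \<beta> (m x \<xi> b)) \<alpha> (m a \<gamma> y)"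
    using * assms by (intro left_swap m_closed)
  finally show ?thesis
    by (rule that[rotated -1]) (use * assms in \<open>auto intro: m_closed\<close>)
qed

end

section \<open>Bounds for the fuzzy product and the implications that need no
  intra-regularity\<close>

context gamma_groupoid
begin

lemma fuzzy_prod_ge:
  assumes "fuzzy_subset S f" "fuzzy_subset S g" "b \<in> S" "\<alpha> \<in> G" "c \<in> S"
  shows "min (f b) (g c) \<le> fuzzy_prod S G m f g (m b \<alpha> c)"
proof -
  let ?A = "{min (f b') (g c') | b' \<alpha>' c'.
    b' \<in> S \<and> \<alpha>' \<in> G \<and> c' \<in> S \<and> m b \<alpha> c = m b' \<alpha>' c'}"
  \<comment> \<open>A real supremum dominates its members only if the set is bounded; 1 is a bound
    because each minimum is at most a value of \<open>f\<close>.\<close>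
  have "bdd_above ?A"
    using assms(1) by (intro bdd_aboveI[of _ 1]) (force simp: fuzzy_subset_def)
  moreover have "min (f b) (g c) \<in> ?A" using assms by blast
  ultimately have "min (f b) (g c) \<le> Sup ?A" by (rule cSup_upper[rotated])
  then show ?thesis using assms unfolding fuzzy_prod_def by auto
qed

text \<open>The premise \<open>0 \<le> r\<close> covers elements without a factorization, where the
  product has the default value 0; otherwise the supremum is over a nonempty set.\<close>

lemma fuzzy_prod_le:
  assumes "0 \<le> r"
    and "\<And>b \<alpha> c. \<lbrakk>b \<in> S; \<alpha> \<in> G; c \<in> S; a = m b \<alpha> c\<rbrakk> \<Longrightarrow> min (f b) (g c) \<le> r"
  shows "fuzzy_prod S G m f g a \<le> r"
proof (cases "\<exists>b\<in>S. \<exists>\<alpha>\<in>G. \<exists>c\<in>S. a = m b \<alpha> c")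
  case True
  then have "{min (f b) (g c) | b \<alpha> c. b \<in> S \<and> \<alpha> \<in> G \<and> c \<in> S \<and> a = m b \<alpha> c} \<noteq> {}"
    by blast
  then have "Sup {min (f b) (g c) | b \<alpha> c. b \<in> S \<and> \<alpha> \<in> G \<and> c \<in> S \<and> a = m b \<alpha> c} \<le> r"
    by (rule cSup_least) (use assms(2) in blast)
  with True show ?thesis by (simp add: fuzzy_prod_def)
next
  case False
  then show ?thesis unfolding fuzzy_prod_def using assms(1) by (subst if_not_P)
qed

lemma fuzzy_subset_whole: "fuzzy_subset S fuzzy_whole"
  by (simp add: fuzzy_subset_def fuzzy_whole_def)

text \<open>Values of \<open>f\<close> are at most 1, so the minimum with \<open>fuzzy_whole\<close>
  is the value of \<open>f\<close> itself.\<close>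

lemma fuzzy_prod_whole_right_ge:
  assumes "fuzzy_subset S f" "b \<in> S" "\<alpha> \<in> G" "c \<in> S"
  shows "f b \<le> fuzzy_prod S G m f fuzzy_whole (m b \<alpha> c)"
proof -
  have "f b \<le> 1" using assms by (auto simp: fuzzy_subset_def)
  with fuzzy_prod_ge[OF assms(1) fuzzy_subset_whole assms(2-4)] show ?thesis
    by (simp add: fuzzy_whole_def)
qed

lemma fuzzy_prod_whole_left_ge:
  assumes "fuzzy_subset S f" "b \<in> S" "\<alpha> \<in> G" "c \<in> S"
  shows "f c \<le> fuzzy_prod S G m fuzzy_whole f (m b \<alpha> c)"
proof -
  have "f c \<le> 1" using assms by (auto simp: fuzzy_subset_def)
  with fuzzy_prod_ge[OF fuzzy_subset_whole assms] show ?thesis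
    by (simp add: fuzzy_whole_def)
qed

lemma fuzzy_right_ideal_prod_le:
  assumes "fuzzy_subset S f" "fuzzy_right_ideal S G m f" "a \<in> S"
  shows "fuzzy_prod S G m f fuzzy_whole a \<le> f a"
  using assms
  by (intro fuzzy_prod_le) (auto simp: fuzzy_subset_def fuzzy_right_ideal_def min_le_iff_disj)

lemma fuzzy_left_ideal_prod_le:
  assumes "fuzzy_subset S f" "fuzzy_left_ideal S G m f" "a \<in> S"
  shows "fuzzy_prod S G m fuzzy_whole f a \<le> f a"
  using assms
  by (intro fuzzy_prod_le) (auto simp: fuzzy_subset_def fuzzy_left_ideal_def min_le_iff_disj)

lemma fuzzy_right_ideal_imp_quasi_ideal:
  assumes "fuzzy_subset S f" "fuzzy_right_ideal S G m f"
  shows "fuzzy_quasi_ideal S G m f"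
  using fuzzy_right_ideal_prod_le[OF assms]
  by (simp add: fuzzy_quasi_ideal_def fuzzy_le_def fuzzy_inter_def min_le_iff_disj)

lemma fuzzy_two_sided_ideal_imp_bi_ideal:
  assumes "fuzzy_two_sided_ideal S G m f"
  shows "fuzzy_bi_ideal S G m f"
  using assms m_closed
  by (auto simp: fuzzy_two_sided_ideal_def fuzzy_left_ideal_def fuzzy_bi_ideal_def
      fuzzy_AG_subgroupoid_def min_le_iff_disj)

text \<open>In \<open>(xy)z\<close> the right ideal inequality strips off \<open>z\<close> and the
  left one strips off \<open>x\<close>.\<close>

lemma fuzzy_two_sided_ideal_imp_interior_ideal:
  assumes "fuzzy_two_sided_ideal S G m f"
  shows "fuzzy_interior_ideal S G m f"
  using assms unfolding fuzzy_two_sided_ideal_def fuzzy_left_ideal_def fuzzy_right_ideal_def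
    fuzzy_interior_ideal_def by (meson m_closed order_trans)

text \<open>The factorization of \<open>ab\<close> into \<open>a\<close> and \<open>b\<close> itself
  contributes \<open>f a\<close> to the supremum that equals \<open>f\<close> at
  \<open>ab\<close>.\<close>

lemma fuzzy_prod_whole_eq_imp_right_ideal:
  assumes "fuzzy_subset S f" "fuzzy_eq S f (fuzzy_prod S G m f fuzzy_whole)"
  shows "fuzzy_right_ideal S G m f"
  unfolding fuzzy_right_ideal_def
proof (intro ballI)
  fix a b \<alpha> assume ab: "a \<in> S" "b \<in> S" "\<alpha> \<in> G"
  have "f (m a \<alpha> b) = fuzzy_prod S G m f fuzzy_whole (m a \<alpha> b)"
    using assms(2) ab m_closed unfolding fuzzy_eq_def by blast
  then show "f a \<le> f (m a \<alpha> b)"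
    using fuzzy_prod_whole_right_ge[OF assms(1)] ab by metis
qed

end

section \<open>Implications that use intra-regularity\<close>

context gamma_AG_star_star_groupoid
begin

lemma fuzzy_left_ideal_imp_right_ideal:
  assumes "intra_regular S G m" "fuzzy_left_ideal S G m f"
  shows "fuzzy_right_ideal S G m f"
  unfolding fuzzy_right_ideal_def
proof (intro ballI)
  fix a b \<alpha> assume ab: "a \<in> S" "b \<in> S" "\<alpha> \<in> G"
  obtain p q \<beta> \<gamma> \<delta> where *: "p \<in> S" "q \<in> S" "\<beta> \<in> G" "\<gamma> \<in> G" "\<delta> \<in> G"
    "m a \<alpha> b = m a \<beta> (m p \<gamma> (m q \<delta> a))"
    using assms(1) ab by (rule prod_eq_left_multiple)
  have "f a \<le> f (m q \<delta> a)" "f (m q \<delta> a) \<le> f (m p \<gamma> (m q \<delta> a))"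
    "f (m p \<gamma> (m q \<delta> a)) \<le> f (m a \<beta> (m p \<gamma> (m q \<delta> a)))"
    using assms(2) * ab m_closed unfolding fuzzy_left_ideal_def by simp_all
  with * show "f a \<le> f (m a \<alpha> b)" by simp
qed

lemma fuzzy_right_ideal_imp_left_ideal:
  assumes "intra_regular S G m" "fuzzy_right_ideal S G m f"
  shows "fuzzy_left_ideal S G m f"
  unfolding fuzzy_left_ideal_def
proof (intro ballI)
  fix a b \<alpha> assume ab: "a \<in> S" "b \<in> S" "\<alpha> \<in> G"
  obtain s t \<beta> \<gamma> where *: "s \<in> S" "t \<in> S" "\<beta> \<in> G" "\<gamma> \<in> G" "m a \<alpha> b = m (m b \<beta> s) \<gamma> t"
    using assms(1) ab by (rule prod_eq_multiple_of_right_factor)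
  have "f b \<le> f (m b \<beta> s)" "f (m b \<beta> s) \<le> f (m (m b \<beta> s) \<gamma> t)"
    using assms(2) * ab m_closed unfolding fuzzy_right_ideal_def by simp_all
  with * show "f b \<le> f (m a \<alpha> b)" by simp
qed

lemma fuzzy_generalized_bi_ideal_imp_right_ideal:
  assumes "intra_regular S G m" "fuzzy_generalized_bi_ideal S G m f"
  shows "fuzzy_right_ideal S G m f"
  unfolding fuzzy_right_ideal_def
proof (intro ballI)
  fix a b \<alpha> assume ab: "a \<in> S" "b \<in> S" "\<alpha> \<in> G"
  obtain t \<beta> \<gamma> where t: "t \<in> S" "\<beta> \<in> G" "\<gamma> \<in> G" "m a \<alpha> b = m (m t \<beta> a) \<gamma> a"
    using assms(1) ab by (rule prod_eq_twice_right_multiple)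
  obtain s \<delta> where s: "s \<in> S" "\<delta> \<in> G" "m t \<beta> a = m a \<delta> s"
    using assms(1) ab(1) t(1,2) by (rule right_multiple_eq_left_multiple)
  \<comment> \<open>Combining both rewritings, \<open>ab = (ta)a = (as)a\<close> has
    \<open>a\<close> at both ends, so the bi-ideal bound collapses to \<open>f a\<close>.\<close>
  have "min (f a) (f a) \<le> f (m (m a \<delta> s) \<gamma> a)"
    using assms(2) s t ab unfolding fuzzy_generalized_bi_ideal_def by blast
  with s t show "f a \<le> f (m a \<alpha> b)" by simp
qed

lemma fuzzy_interior_ideal_imp_right_ideal:
  assumes "intra_regular S G m" "fuzzy_interior_ideal S G m f"
  shows "fuzzy_right_ideal S G m f"
  unfolding fuzzy_right_ideal_def
proof (intro ballI)
  fix a b \<alpha> assume ab: "a \<in> S" "b \<in> S" "\<alpha> \<in> G"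
  \<comment> \<open>Here the first \<open>a\<close> of \<open>(ta)a\<close> serves as the middle
    factor.\<close>
  obtain t \<beta> \<gamma> where "t \<in> S" "\<beta> \<in> G" "\<gamma> \<in> G" "m a \<alpha> b = m (m t \<beta> a) \<gamma> a"
    using assms(1) ab by (rule prod_eq_twice_right_multiple)
  then show "f a \<le> f (m a \<alpha> b)"
    using assms(2) ab unfolding fuzzy_interior_ideal_def by simp
qed

lemma fuzzy_quasi_ideal_imp_right_ideal:
  assumes "intra_regular S G m" "fuzzy_subset S f" "fuzzy_quasi_ideal S G m f"
  shows "fuzzy_right_ideal S G m f"
  unfolding fuzzy_right_ideal_def
proof (intro ballI)
  fix a b \<alpha> assume ab: "a \<in> S" "b \<in> S" "\<alpha> \<in> G"
  obtain t \<beta> \<gamma> where t: "t \<in> S" "\<beta> \<in> G" "\<gamma> \<in> G" "m a \<alpha> b = m (m t \<beta> a) \<gamma> a"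
    using assms(1) ab by (rule prod_eq_twice_right_multiple)
  \<comment> \<open>One element is factored in two ways: \<open>ab\<close> has \<open>a\<close> on
    the left, while \<open>(ta)a\<close> has it on the right. Both products are thus at least
    \<open>f a\<close> there.\<close>
  have "f a \<le> fuzzy_prod S G m f fuzzy_whole (m a \<alpha> b)"
    using assms(2) ab by (intro fuzzy_prod_whole_right_ge)
  moreover have "f a \<le> fuzzy_prod S G m fuzzy_whole f (m a \<alpha> b)"
    unfolding t(4) using assms(2) ab t(1-3) by (intro fuzzy_prod_whole_left_ge m_closed)
  moreover have "min (fuzzy_prod S G m f fuzzy_whole (m a \<alpha> b))
      (fuzzy_prod S G m fuzzy_whole f (m a \<alpha> b)) \<le> f (m a \<alpha> b)"
    using assms(3) ab m_closed
    unfolding fuzzy_quasi_ideal_def fuzzy_le_def fuzzy_inter_def by blast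
  ultimately show "f a \<le> f (m a \<alpha> b)" by linarith
qed

lemma fuzzy_left_ideal_imp_prod_whole_eq:
  assumes "intra_regular S G m" "fuzzy_subset S f" "fuzzy_left_ideal S G m f"
  shows "fuzzy_eq S (fuzzy_prod S G m fuzzy_whole f) f"
  unfolding fuzzy_eq_def
proof (intro ballI antisym)
  fix a assume a: "a \<in> S"
  show "fuzzy_prod S G m fuzzy_whole f a \<le> f a"
    using assms(2,3) a by (rule fuzzy_left_ideal_prod_le)
  obtain u \<gamma> where "u \<in> S" "\<gamma> \<in> G" "a = m u \<gamma> a"
    using assms(1) a by (rule factor_right)
  then show "f a \<le> fuzzy_prod S G m fuzzy_whole f a"
    using fuzzy_prod_whole_left_ge[OF assms(2) _ _ a] by metis
qed

lemma fuzzy_right_ideal_imp_prod_whole_eq: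
  assumes "intra_regular S G m" "fuzzy_subset S f" "fuzzy_right_ideal S G m f"
  shows "fuzzy_eq S f (fuzzy_prod S G m f fuzzy_whole)"
  unfolding fuzzy_eq_def
proof (intro ballI antisym)
  fix a assume a: "a \<in> S"
  show "fuzzy_prod S G m f fuzzy_whole a \<le> f a"
    using assms(2,3) a by (rule fuzzy_right_ideal_prod_le)
  obtain x y \<beta> \<gamma> \<xi> where *: "x \<in> S" "y \<in> S" "\<beta> \<in> G" "\<gamma> \<in> G" "\<xi> \<in> G"
    "a = m (m a \<beta> (m x \<xi> a)) \<gamma> y"
    using assms(1) a by (rule intra_regularE)
  \<comment> \<open>With \<open>a = (a(xa))y\<close>, the ideal property bounds \<open>f\<close> at
    the left factor \<open>a(xa)\<close>, and this factorization enters the supremum at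
    \<open>a\<close>.\<close>
  have "f a \<le> f (m a \<beta> (m x \<xi> a))"
    using assms(3) * a m_closed unfolding fuzzy_right_ideal_def by blast
  also have "\<dots> \<le> fuzzy_prod S G m f fuzzy_whole (m (m a \<beta> (m x \<xi> a)) \<gamma> y)"
    using assms(2) * a by (intro fuzzy_prod_whole_right_ge m_closed)
  also note *(6)[symmetric]
  finally show "f a \<le> fuzzy_prod S G m f fuzzy_whole a" .
qed

end

theorem theorem14:
  fixes S :: "'s set" and G :: "'g set" and m :: "'s \<Rightarrow> 'g \<Rightarrow> 's \<Rightarrow> 's"
    and f :: "'s \<Rightarrow> real"
  assumes "gamma_AG_star_star_groupoid S G m"
    and "intra_regular S G m"
    and "fuzzy_subset S f"
  shows "(fuzzy_left_ideal S G m f \<longleftrightarrow> fuzzy_right_ideal S G m f) \<and>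
    (fuzzy_right_ideal S G m f \<longleftrightarrow> fuzzy_two_sided_ideal S G m f) \<and>
    (fuzzy_two_sided_ideal S G m f \<longleftrightarrow> fuzzy_bi_ideal S G m f) \<and>
    (fuzzy_bi_ideal S G m f \<longleftrightarrow> fuzzy_generalized_bi_ideal S G m f) \<and>
    (fuzzy_generalized_bi_ideal S G m f \<longleftrightarrow> fuzzy_interior_ideal S G m f) \<and>
    (fuzzy_interior_ideal S G m f \<longleftrightarrow> fuzzy_quasi_ideal S G m f) \<and>
    (fuzzy_quasi_ideal S G m f \<longleftrightarrow>
      fuzzy_eq S (fuzzy_prod S G m fuzzy_whole f) f \<and>
      fuzzy_eq S f (fuzzy_prod S G m f fuzzy_whole))"
proof -
  interpret gamma_AG_star_star_groupoid S G m by fact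
  let ?R = "fuzzy_right_ideal S G m f"
  note ir = assms(2) and f = assms(3)
  have left: "fuzzy_left_ideal S G m f \<longleftrightarrow> ?R"
    using fuzzy_left_ideal_imp_right_ideal[OF ir] fuzzy_right_ideal_imp_left_ideal[OF ir] by blast
  then have two: "fuzzy_two_sided_ideal S G m f \<longleftrightarrow> ?R"
    by (auto simp: fuzzy_two_sided_ideal_def)
  have bi_gen: "fuzzy_bi_ideal S G m f \<Longrightarrow> fuzzy_generalized_bi_ideal S G m f"
    by (simp add: fuzzy_bi_ideal_def fuzzy_generalized_bi_ideal_def)
  \<comment> \<open>A cycle: right, two-sided, bi-ideal, generalized bi-ideal, and back to
    right.\<close>
  have bi: "fuzzy_bi_ideal S G m f \<longleftrightarrow> ?R"
    and gen: "fuzzy_generalized_bi_ideal S G m f \<longleftrightarrow> ?R"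
    using two bi_gen fuzzy_two_sided_ideal_imp_bi_ideal
      fuzzy_generalized_bi_ideal_imp_right_ideal[OF ir] by blast+
  have int: "fuzzy_interior_ideal S G m f \<longleftrightarrow> ?R"
    using two fuzzy_two_sided_ideal_imp_interior_ideal
      fuzzy_interior_ideal_imp_right_ideal[OF ir] by blast
  have quasi: "fuzzy_quasi_ideal S G m f \<longleftrightarrow> ?R"
    using fuzzy_right_ideal_imp_quasi_ideal[OF f] fuzzy_quasi_ideal_imp_right_ideal[OF ir f]
    by blast
  \<comment> \<open>Given \<open>?R\<close>, the left ideal property yields the first equation and
    \<open>?R\<close> the second; conversely the second equation returns \<open>?R\<close>.\<close>
  have eq: "fuzzy_eq S (fuzzy_prod S G m fuzzy_whole f) f \<and>
      fuzzy_eq S f (fuzzy_prod S G m f fuzzy_whole) \<longleftrightarrow> ?R"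
    using left fuzzy_left_ideal_imp_prod_whole_eq[OF ir f]
      fuzzy_right_ideal_imp_prod_whole_eq[OF ir f] fuzzy_prod_whole_eq_imp_right_ideal[OF f]
    by blast
  show ?thesis
    using left two bi gen int quasi eq by argo
qed

end
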